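(* Let $A$ be a Jacobi-Jordan (JJ) algebra over a field $k$, $E$ a vector space and $\pi:E\to A$ an epimorphism of vector spaces with $V=\mathrm{Ker}(\pi)$. Then $$\mathbb{GH}^2(A,V)=\bigsqcup_{\cdot_V}\ \mathbb{H}^2\bigl(A,(V,\cdot_V)\bigr),$$ where the coproduct on the right hand side is the disjoint union of sets over all possible JJ algebra structures $\cdot_V$ on the vector space $V$.
   Context: $k$ is an arbitrary field. A JJ algebra is a $k$-vector space $A$ with a bilinear map $\cdot:A\times A\to A$ such that $a\cdot b=b\cdot a$ and $a\cdot(b\cdot c)+b\cdot(c\cdot a)+c\cdot(a\cdot b)=0$. $\mathcal{CS}(A,V)$ is the set of crossed systems of $A$ by $V$: triples $(\triangleright,\vartheta,\cdot_V)$ of bilinear maps $\triangleright:A\times V\to V$, $\vartheta:A\times A\to V$, $\cdot_V:V\times V\to V$ such that $A\times V$ with multiplication $(a,x)\bullet(b,y):=(a\cdot b,\ \vartheta(a,b)+a\triangleright y+b\triangleright x+x\cdot_V y)$ is a JJ algebra (then $(V,\cdot_V)$ is a JJ algebra). $(\triangleright,\vartheta,\cdot_V)\approx(\triangleright',\vartheta',\cdot_V')$ means that $\cdot_V=\cdot_V'$ and there is a linear map $r:A\to V$ with $a\triangleright x=a\triangleright' x+r(a)\cdot_V' x$ and $\vartheta(a,b)=\vartheta'(a,b)+a\triangleright' r(b)+b\triangleright' r(a)+r(a)\cdot_V' r(b)-r(a\cdot b)$ for all $a,b\in A$, $x\in V$. This is an equivalence relation and $\mathbb{GH}^2(A,V):=\mathcal{CS}(A,V)/\approx$.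 For a fixed JJ algebra structure $\cdot_V$ on $V$, $\mathcal{CS}_{\cdot_V}(A,V)$ is the set of pairs $(\triangleright,\vartheta)$ with $(\triangleright,\vartheta,\cdot_V)\in\mathcal{CS}(A,V)$; $(\triangleright,\vartheta)\approx_{\cdot_V}(\triangleright',\vartheta')$ means that a linear map $r:A\to V$ exists satisfying the two displayed conditions with $\cdot_V'=\cdot_V$; and $\mathbb{H}^2(A,(V,\cdot_V)):=\mathcal{CS}_{\cdot_V}(A,V)/\approx_{\cdot_V}$. In the equality, the class of $(\triangleright,\vartheta)$ in the component indexed by $\cdot_V$ is identified with the class of $(\triangleright,\vartheta,\cdot_V)$. *)

theory Defs
  imports "HOL-Analysis.Product_Vector" "HOL-Library.FuncSet"
begin

text \<open>
  A vector space over a field is given by its scalar multiplication (locale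
  \<^locale>\<open>vector_space\<close>).  The kernel \<open>V\<close> is a subset of the ambient type, so bilinearity and
  algebra structures are relativised to carriers.  Maps with arguments in \<open>V\<close> are taken
  extensional (\<^const>\<open>PiE\<close>, \<^const>\<open>extensional\<close>), so that each map out of \<open>V\<close> is represented by
  exactly one HOL function and the sets below contain no spurious copies.
\<close>

definition bilinear_on ::
  "('k::field \<Rightarrow> 'a::ab_group_add \<Rightarrow> 'a) \<Rightarrow> ('k \<Rightarrow> 'b::ab_group_add \<Rightarrow> 'b) \<Rightarrow>
   ('k \<Rightarrow> 'c::ab_group_add \<Rightarrow> 'c) \<Rightarrow> 'a set \<Rightarrow> 'b set \<Rightarrow> 'c set \<Rightarrow> ('a \<Rightarrow> 'b \<Rightarrow> 'c) \<Rightarrow> bool"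
  where "bilinear_on s1 s2 s3 S T U f \<longleftrightarrow>
    (\<forall>x\<in>S. \<forall>y\<in>T. f x y \<in> U) \<and>
    (\<forall>x\<in>S. \<forall>x'\<in>S. \<forall>y\<in>T. f (x + x') y = f x y + f x' y) \<and>
    (\<forall>c. \<forall>x\<in>S. \<forall>y\<in>T. f (s1 c x) y = s3 c (f x y)) \<and>
    (\<forall>x\<in>S. \<forall>y\<in>T. \<forall>y'\<in>T. f x (y + y') = f x y + f x y') \<and>
    (\<forall>c. \<forall>x\<in>S. \<forall>y\<in>T. f x (s2 c y) = s3 c (f x y))"

locale jj_algebra_on = vector_space scale
  for scale :: "'k::field \<Rightarrow> 'a::ab_group_add \<Rightarrow> 'a" +
  fixes S :: "'a set" and mult :: "'a \<Rightarrow> 'a \<Rightarrow> 'a"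
  assumes subspace_carrier: "subspace S"
    and bilinear_mult: "bilinear_on scale scale scale S S S mult"
    and mult_commute: "\<And>a b. a \<in> S \<Longrightarrow> b \<in> S \<Longrightarrow> mult a b = mult b a"
    and jacobi: "\<And>a b c. a \<in> S \<Longrightarrow> b \<in> S \<Longrightarrow> c \<in> S \<Longrightarrow>
      mult a (mult b c) + mult b (mult c a) + mult c (mult a b) = 0"

definition jj_structures ::
  "('k::field \<Rightarrow> 'v::ab_group_add \<Rightarrow> 'v) \<Rightarrow> 'v set \<Rightarrow> ('v \<Rightarrow> 'v \<Rightarrow> 'v) set"
  where "jj_structures sV V = {m \<in> V \<rightarrow>\<^sub>E (V \<rightarrow>\<^sub>E V). jj_algebra_on sV V m}"

definition crossed_mult ::
  "('a::ab_group_add \<Rightarrow> 'a \<Rightarrow> 'a) \<Rightarrow> ('a \<Rightarrow> 'v::ab_group_add \<Rightarrow> 'v) \<Rightarrow> ('a \<Rightarrow> 'a \<Rightarrow> 'v) \<Rightarrow>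
   ('v \<Rightarrow> 'v \<Rightarrow> 'v) \<Rightarrow> 'a \<times> 'v \<Rightarrow> 'a \<times> 'v \<Rightarrow> 'a \<times> 'v"
  where "crossed_mult mA act \<theta> m = (\<lambda>(a, x) (b, y). (mA a b, \<theta> a b + act a y + act b x + m x y))"

definition crossed_systems ::
  "('k::field \<Rightarrow> 'a::ab_group_add \<Rightarrow> 'a) \<Rightarrow> ('a \<Rightarrow> 'a \<Rightarrow> 'a) \<Rightarrow>
   ('k \<Rightarrow> 'v::ab_group_add \<Rightarrow> 'v) \<Rightarrow> 'v set \<Rightarrow>
   (('a \<Rightarrow> 'v \<Rightarrow> 'v) \<times> ('a \<Rightarrow> 'a \<Rightarrow> 'v) \<times> ('v \<Rightarrow> 'v \<Rightarrow> 'v)) set"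
  where "crossed_systems sA mA sV V = {(act, \<theta>, m).
    (\<forall>a. act a \<in> extensional V) \<and> bilinear_on sA sV sV UNIV V V act \<and>
    bilinear_on sA sA sV UNIV UNIV V \<theta> \<and>
    m \<in> V \<rightarrow>\<^sub>E (V \<rightarrow>\<^sub>E V) \<and> bilinear_on sV sV sV V V V m \<and>
    jj_algebra_on (module_prod.scale sA sV) (UNIV \<times> V) (crossed_mult mA act \<theta> m)}"

definition crossed_systems_fixed ::
  "('k::field \<Rightarrow> 'a::ab_group_add \<Rightarrow> 'a) \<Rightarrow> ('a \<Rightarrow> 'a \<Rightarrow> 'a) \<Rightarrow>
   ('k \<Rightarrow> 'v::ab_group_add \<Rightarrow> 'v) \<Rightarrow> 'v set \<Rightarrow> ('v \<Rightarrow> 'v \<Rightarrow> 'v) \<Rightarrow>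
   (('a \<Rightarrow> 'v \<Rightarrow> 'v) \<times> ('a \<Rightarrow> 'a \<Rightarrow> 'v)) set"
  where "crossed_systems_fixed sA mA sV V m =
    {(act, \<theta>). (act, \<theta>, m) \<in> crossed_systems sA mA sV V}"

text \<open>The two compatibility conditions; \<open>m\<close> is the (common) multiplication on \<open>V\<close>.\<close>

definition cohomologous_via ::
  "('a::ab_group_add \<Rightarrow> 'a \<Rightarrow> 'a) \<Rightarrow> 'v::ab_group_add set \<Rightarrow> ('v \<Rightarrow> 'v \<Rightarrow> 'v) \<Rightarrow> ('a \<Rightarrow> 'v) \<Rightarrow>
   ('a \<Rightarrow> 'v \<Rightarrow> 'v) \<times> ('a \<Rightarrow> 'a \<Rightarrow> 'v) \<Rightarrow> ('a \<Rightarrow> 'v \<Rightarrow> 'v) \<times> ('a \<Rightarrow> 'a \<Rightarrow> 'v) \<Rightarrow> bool"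
  where "cohomologous_via mA V m r = (\<lambda>(act, \<theta>) (act', \<theta>').
    (\<forall>a. \<forall>x\<in>V. act a x = act' a x + m (r a) x) \<and>
    (\<forall>a b. \<theta> a b = \<theta>' a b + act' a (r b) + act' b (r a) + m (r a) (r b) - r (mA a b)))"

definition crossed_rel ::
  "('k::field \<Rightarrow> 'a::ab_group_add \<Rightarrow> 'a) \<Rightarrow> ('a \<Rightarrow> 'a \<Rightarrow> 'a) \<Rightarrow>
   ('k \<Rightarrow> 'v::ab_group_add \<Rightarrow> 'v) \<Rightarrow> 'v set \<Rightarrow>
   (('a \<Rightarrow> 'v \<Rightarrow> 'v) \<times> ('a \<Rightarrow> 'a \<Rightarrow> 'v) \<times> ('v \<Rightarrow> 'v \<Rightarrow> 'v)) rel"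
  where "crossed_rel sA mA sV V = {((act, \<theta>, m), (act', \<theta>', m')).
    (act, \<theta>, m) \<in> crossed_systems sA mA sV V \<and> (act', \<theta>', m') \<in> crossed_systems sA mA sV V \<and>
    m = m' \<and>
    (\<exists>r. Vector_Spaces.linear sA sV r \<and> range r \<subseteq> V \<and>
      cohomologous_via mA V m' r (act, \<theta>) (act', \<theta>'))}"

definition crossed_rel_fixed ::
  "('k::field \<Rightarrow> 'a::ab_group_add \<Rightarrow> 'a) \<Rightarrow> ('a \<Rightarrow> 'a \<Rightarrow> 'a) \<Rightarrow>
   ('k \<Rightarrow> 'v::ab_group_add \<Rightarrow> 'v) \<Rightarrow> 'v set \<Rightarrow> ('v \<Rightarrow> 'v \<Rightarrow> 'v) \<Rightarrow>
   (('a \<Rightarrow> 'v \<Rightarrow> 'v) \<times> ('a \<Rightarrow> 'a \<Rightarrow> 'v)) rel"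
  where "crossed_rel_fixed sA mA sV V m = {(p, p').
    p \<in> crossed_systems_fixed sA mA sV V m \<and> p' \<in> crossed_systems_fixed sA mA sV V m \<and>
    (\<exists>r. Vector_Spaces.linear sA sV r \<and> range r \<subseteq> V \<and> cohomologous_via mA V m r p p')}"

definition GH2 ::
  "('k::field \<Rightarrow> 'a::ab_group_add \<Rightarrow> 'a) \<Rightarrow> ('a \<Rightarrow> 'a \<Rightarrow> 'a) \<Rightarrow>
   ('k \<Rightarrow> 'v::ab_group_add \<Rightarrow> 'v) \<Rightarrow> 'v set \<Rightarrow>
   (('a \<Rightarrow> 'v \<Rightarrow> 'v) \<times> ('a \<Rightarrow> 'a \<Rightarrow> 'v) \<times> ('v \<Rightarrow> 'v \<Rightarrow> 'v)) set set"
  where "GH2 sA mA sV V = crossed_systems sA mA sV V // crossed_rel sA mA sV V"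

definition H2 ::
  "('k::field \<Rightarrow> 'a::ab_group_add \<Rightarrow> 'a) \<Rightarrow> ('a \<Rightarrow> 'a \<Rightarrow> 'a) \<Rightarrow>
   ('k \<Rightarrow> 'v::ab_group_add \<Rightarrow> 'v) \<Rightarrow> 'v set \<Rightarrow> ('v \<Rightarrow> 'v \<Rightarrow> 'v) \<Rightarrow>
   (('a \<Rightarrow> 'v \<Rightarrow> 'v) \<times> ('a \<Rightarrow> 'a \<Rightarrow> 'v)) set set"
  where "H2 sA mA sV V m =
    crossed_systems_fixed sA mA sV V m // crossed_rel_fixed sA mA sV V m"

end

theory Submission
  imports Defs
begin

text \<open>Equivalent crossed systems have the same multiplication on \<open>V\<close>, so every
  class of \<open>crossed_rel\<close> lies in the fibre over a single \<open>m\<close>, where it is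
  a class of \<open>crossed_rel_fixed\<close> with \<open>m\<close> appended to each member
  (\<open>crossed_rel_Image\<close>). The bijection is this appending. It is injective because
  \<open>m\<close> can be read off any member of the image of a class, and classes are nonempty by
  reflexivity (\<open>crossed_rel_fixed_refl\<close>). It is surjective because the \<open>m\<close>
  of a crossed system is always a JJ structure on \<open>V\<close>, hence one of the indices of the
  union (\<open>crossed_systems_imp_jj_structure\<close>).\<close>

lemma bilinear_on_zero_left:
  assumes "bilinear_on s1 s2 s3 S T U f" "0 \<in> S" "y \<in> T"
  shows "f 0 y = 0"
proof -
  have "f (0 + 0) y = f 0 y + f 0 y"
    using assms unfolding bilinear_on_def by blast
  then show ?thesis by simp
qed

lemma bilinear_on_zero_right:
  assumes "bilinear_on s1 s2 s3 S T U f" "x \<in> S" "0 \<in> T"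
  shows "f x 0 = 0"
proof -
  have "f x (0 + 0) = f x 0 + f x 0"
    using assms unfolding bilinear_on_def by blast
  then show ?thesis by simp
qed

text \<open>The copy \<open>{0}\<close> \<times> \<open>V\<close> of \<open>V\<close> is closed
  under the crossed product, which restricts to \<open>m\<close> there; commutativity and the Jacobi
  identity are inherited.\<close>

lemma crossed_systems_imp_jj_structure:
  assumes A: "jj_algebra_on sA UNIV mA"
    and "vector_space sV" and V: "module.subspace sV V"
    and cs: "(act, \<theta>, m) \<in> crossed_systems sA mA sV V"
  shows "m \<in> jj_structures sV V"
proof -
  interpret V: vector_space sV by fact
  from cs have bil_act: "bilinear_on sA sV sV UNIV V V act"
    and bil_\<theta>: "bilinear_on sA sA sV UNIV UNIV V \<theta>"
    and ext_m: "m \<in> V \<rightarrow>\<^sub>E (V \<rightarrow>\<^sub>E V)"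
    and bil_m: "bilinear_on sV sV sV V V V m"
    and jj: "jj_algebra_on (module_prod.scale sA sV) (UNIV \<times> V) (crossed_mult mA act \<theta> m)"
    by (auto simp: crossed_systems_def)
  have "mA 0 0 = 0"
    using bilinear_on_zero_left[OF jj_algebra_on.bilinear_mult[OF A]] by simp
  \<comment> \<open>Every term with an argument from \<open>A\<close> vanishes by bilinearity,
    leaving only \<open>m x y\<close>.\<close>
  then have mult_0: "crossed_mult mA act \<theta> m (0, x) (0, y) = (0, m x y)"
    if "x \<in> V" "y \<in> V" for x y
    using that bilinear_on_zero_left[OF bil_act] bilinear_on_zero_left[OF bil_\<theta>]
    by (simp add: crossed_mult_def)
  have m_closed: "m x y \<in> V" if "x \<in> V" "y \<in> V" for x y
    using that ext_m by (auto simp: PiE_iff)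
  have "jj_algebra_on sV V m"
  proof unfold_locales
    show "V.subspace V" "bilinear_on sV sV sV V V V m" by fact+
    show "m x y = m y x" if "x \<in> V" "y \<in> V" for x y
      using jj_algebra_on.mult_commute[OF jj, of "(0, x)" "(0, y)"] that by (simp add: mult_0)
    show "m x (m y z) + m y (m z x) + m z (m x y) = 0"
      if "x \<in> V" "y \<in> V" "z \<in> V" for x y z
      using jj_algebra_on.jacobi[OF jj, of "(0, x)" "(0, y)" "(0, z)"] that
      by (simp add: mult_0 m_closed zero_prod_def)
  qed
  with ext_m show ?thesis by (simp add: jj_structures_def)
qed

text \<open>The zero map serves as \<open>r\<close>: all correction terms in both conditions vanish.
  This makes each class contain its representative.\<close>

lemma crossed_rel_fixed_refl:
  assumes A: "jj_algebra_on sA UNIV mA"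
    and "vector_space sV" and V: "module.subspace sV V"
    and p: "p \<in> crossed_systems_fixed sA mA sV V m"
  shows "(p, p) \<in> crossed_rel_fixed sA mA sV V m"
proof -
  interpret A: jj_algebra_on sA UNIV mA by fact
  interpret V: vector_space sV by fact
  interpret vector_space_pair sA sV ..
  have "0 \<in> V" using V by (rule V.subspace_0)
  obtain act \<theta> where p_eq: "p = (act, \<theta>)" by (cases p)
  with p have act: "bilinear_on sA sV sV UNIV V V act" and m: "bilinear_on sV sV sV V V V m"
    by (auto simp: crossed_systems_fixed_def crossed_systems_def)
  have "cohomologous_via mA V m (\<lambda>_. 0) p p"
    using bilinear_on_zero_right[OF act] bilinear_on_zero_left[OF m] \<open>0 \<in> V\<close>
    by (simp add: cohomologous_via_def p_eq)
  moreover have "Vector_Spaces.linear sA sV (\<lambda>_. 0)"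
    by (rule linear_zero)
  moreover have "range (\<lambda>_::'b. 0) \<subseteq> V"
    using \<open>0 \<in> V\<close> by auto
  ultimately show ?thesis
    using p unfolding crossed_rel_fixed_def by blast
qed

text \<open>Since \<open>crossed_rel\<close> demands equal third components and otherwise imposes
  the conditions of \<open>crossed_rel_fixed\<close>, a class never leaves the fibre over
  \<open>m\<close>.\<close>

lemma crossed_rel_Image:
  "crossed_rel sA mA sV V `` {(act, \<theta>, m)} =
    (\<lambda>(act', \<theta>'). (act', \<theta>', m)) ` (crossed_rel_fixed sA mA sV V m `` {(act, \<theta>)})"
  by (force simp: crossed_rel_def crossed_rel_fixed_def crossed_systems_fixed_def)

theorem corollary2p10:
  fixes sA :: "'k::field \<Rightarrow> 'a::ab_group_add \<Rightarrow> 'a"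
    and mA :: "'a \<Rightarrow> 'a \<Rightarrow> 'a"
    and sE :: "'k \<Rightarrow> 'e::ab_group_add \<Rightarrow> 'e"
    and \<pi> :: "'e \<Rightarrow> 'a"
    and V :: "'e set"
  assumes "jj_algebra_on sA UNIV mA"
    and "vector_space sE"
    and "Vector_Spaces.linear sE sA \<pi>"
    and "surj \<pi>"
    and "V = {e. \<pi> e = 0}"
  shows "\<exists>\<Phi>. bij_betw \<Phi> (SIGMA m : jj_structures sE V. H2 sA mA sE V m) (GH2 sA mA sE V) \<and>
    (\<forall>m \<in> jj_structures sE V. \<forall>(act, \<theta>) \<in> crossed_systems_fixed sA mA sE V m.
      \<Phi> (m, crossed_rel_fixed sA mA sE V m `` {(act, \<theta>)})
        = crossed_rel sA mA sE V `` {(act, \<theta>, m)})"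
proof -
  interpret A: jj_algebra_on sA UNIV mA by fact
  interpret E: vector_space sE by fact
  interpret \<pi>: Vector_Spaces.linear sE sA \<pi> by fact
  \<comment> \<open>The kernel of a linear map is a subspace, so \<open>V\<close> can carry algebra
    structures.\<close>
  have V: "E.subspace V"
    using \<pi>.subspace_kernel by (simp add: assms(5))
  define \<iota> :: "('e \<Rightarrow> 'e \<Rightarrow> 'e) \<Rightarrow> ('a \<Rightarrow> 'e \<Rightarrow> 'e) \<times> ('a \<Rightarrow> 'a \<Rightarrow> 'e) \<Rightarrow> _"
    where "\<iota> m = (\<lambda>(act, \<theta>). (act, \<theta>, m))" for m
  define \<Phi> where "\<Phi> = (\<lambda>(m, X). \<iota> m ` X)"
  have \<Phi>_class: "\<Phi> (m, crossed_rel_fixed sA mA sE V m `` {(act, \<theta>)})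
      = crossed_rel sA mA sE V `` {(act, \<theta>, m)}" for m act \<theta>
    by (simp add: \<Phi>_def \<iota>_def crossed_rel_Image)
  have inj_\<iota>: "inj (\<iota> m)" for m
    by (auto simp: \<iota>_def inj_on_def)
  have nonempty: "X \<noteq> {}" if "X \<in> H2 sA mA sE V m" for m X
    using that crossed_rel_fixed_refl[OF assms(1,2) V]
    by (auto simp: H2_def quotient_def)
  have "inj_on \<Phi> (SIGMA m : jj_structures sE V. H2 sA mA sE V m)"
  proof (rule inj_onI, clarify)
    fix m m' X X'
    assume X: "X \<in> H2 sA mA sE V m" and eq: "\<Phi> (m, X) = \<Phi> (m', X')"
    \<comment> \<open>An actual member is needed to recover the index: the empty set would have the
      same image under every \<open>\<iota> m\<close>.\<close>
    obtain p where "p \<in> X" using nonempty[OF X] by blast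
    then have "\<iota> m p \<in> \<iota> m' ` X'"
      using eq by (auto simp: \<Phi>_def)
    then have "m = m'"
      by (auto simp: \<iota>_def split: prod.splits)
    with eq inj_image_eq_iff[OF inj_\<iota>] show "m = m' \<and> X = X'"
      by (simp add: \<Phi>_def)
  qed
  moreover have "\<Phi> ` (SIGMA m : jj_structures sE V. H2 sA mA sE V m) = GH2 sA mA sE V"
  proof (intro equalityI subsetI)
    fix Y
    assume "Y \<in> \<Phi> ` (SIGMA m : jj_structures sE V. H2 sA mA sE V m)"
    then obtain m act \<theta> where "(act, \<theta>, m) \<in> crossed_systems sA mA sE V"
      and "Y = crossed_rel sA mA sE V `` {(act, \<theta>, m)}"
      by (auto simp: H2_def crossed_systems_fixed_def \<Phi>_class elim!: quotientE)
    then show "Y \<in> GH2 sA mA sE V"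
      by (simp add: GH2_def quotientI)
  next
    fix Y
    assume "Y \<in> GH2 sA mA sE V"
    then obtain act \<theta> m where cs: "(act, \<theta>, m) \<in> crossed_systems sA mA sE V"
      and Y: "Y = crossed_rel sA mA sE V `` {(act, \<theta>, m)}"
      by (auto simp: GH2_def elim!: quotientE)
    \<comment> \<open>The preimage of \<open>Y\<close> is the class of the same pair, in the
      component indexed by \<open>m\<close>; that component must be shown to occur in the
      union.\<close>
    have "m \<in> jj_structures sE V"
      using crossed_systems_imp_jj_structure[OF assms(1,2) V cs] .
    moreover have "crossed_rel_fixed sA mA sE V m `` {(act, \<theta>)} \<in> H2 sA mA sE V m"
      using cs by (simp add: H2_def crossed_systems_fixed_def quotientI)
    ultimately show "Y \<in> \<Phi> ` (SIGMA m : jj_structures sE V. H2 sA mA sE V m)"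
      unfolding Y \<Phi>_class[symmetric] by blast
  qed
  ultimately show ?thesis
    using \<Phi>_class by (intro exI[of _ \<Phi>]) (auto simp: bij_betw_def)
qed

end
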